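(* Let $d\geq2$ and $k\geq1$ be fixed, and let $X_1,X_2,\dots$ be a sequence of finite $d$-regular graphs such that $n(X_i)\to\infty$ and, for each $j\geq3$, $c_j(X_i)/n(X_i)\to0$ as $i\to\infty$. Let $A^{[k]}(X_i)$ be the adjacency matrix of the distance-$k$ graph of $X_i$. Then the distribution of $A^{[k]}(X_i)$ with respect to the normalized trace converges in moments, as $i\to\infty$, to the distribution of $A^{[k]}_d$ with respect to the vacuum state; that is, for every $m\geq1$, $$\frac{1}{n(X_i)}\operatorname{Tr}\big(A^{[k]}(X_i)^m\big)\longrightarrow \big((A^{[k]}_d)^m\big)_{rr}.$$
   Context: $n(X)$ is the number of vertices of $X$ and $c_j(X)$ the number of cycles of length $j$ in $X$. The distance-$k$ graph of a graph has the same vertices, with two vertices adjacent iff their graph distance is exactly $k$. $A^{[k]}_d$ is the adjacency matrix of the distance-$k$ graph of the infinite $d$-regular tree and $r$ is any vertex of that tree; $((A^{[k]}_d)^m)_{rr}$ is the number of closed walks of length $m$ from $r$ in that distance-$k$ graph. *)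

theory Defs
  imports "HOL-Analysis.Infinite_Sum" "HOL-Library.Extended_Nat"
begin

text \<open>Simple undirected graphs, possibly infinite; edges are two-element sets of vertices.\<close>

record 'a sgraph =
  verts :: "'a set"
  edges :: "'a set set"

definition simple_graph :: "'a sgraph \<Rightarrow> bool" where
  "simple_graph G \<longleftrightarrow> (\<forall>e\<in>edges G. e \<subseteq> verts G \<and> card e = 2)"

definition finite_graph :: "'a sgraph \<Rightarrow> bool" where
  "finite_graph G \<longleftrightarrow> simple_graph G \<and> finite (verts G)"

definition adjacent :: "'a sgraph \<Rightarrow> 'a \<Rightarrow> 'a \<Rightarrow> bool" where
  "adjacent G u v \<longleftrightarrow> {u, v} \<in> edges G"

definition neighbours :: "'a sgraph \<Rightarrow> 'a \<Rightarrow> 'a set" where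
  "neighbours G v = {w \<in> verts G. adjacent G v w}"

text \<open>The finiteness clause is needed because the cardinality of an infinite set is 0.\<close>

definition regular_graph :: "nat \<Rightarrow> 'a sgraph \<Rightarrow> bool" where
  "regular_graph d G \<longleftrightarrow>
     (\<forall>v\<in>verts G. finite (neighbours G v) \<and> card (neighbours G v) = d)"

text \<open>A walk is the list of its vertices, so its length is one less than that of the list.\<close>

definition walk :: "'a sgraph \<Rightarrow> 'a \<Rightarrow> 'a list \<Rightarrow> 'a \<Rightarrow> bool" where
  "walk G u p v \<longleftrightarrow>
     p \<noteq> [] \<and> hd p = u \<and> last p = v \<and> set p \<subseteq> verts G \<and> successively (adjacent G) p"

definition connected_graph :: "'a sgraph \<Rightarrow> bool" where
  "connected_graph G \<longleftrightarrow> (\<forall>u\<in>verts G. \<forall>v\<in>verts G. \<exists>p. walk G u p v)"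

text \<open>Vertices in different components are at distance \<open>\<infinity>\<close>, the infimum of the empty set.\<close>

definition graph_dist :: "'a sgraph \<Rightarrow> 'a \<Rightarrow> 'a \<Rightarrow> enat" where
  "graph_dist G u v = (INF p\<in>{p. walk G u p v}. enat (length p - 1))"

definition distance_graph :: "nat \<Rightarrow> 'a sgraph \<Rightarrow> 'a sgraph" where
  "distance_graph k G =
     \<lparr>verts = verts G,
      edges = {{u, v} | u v. u \<in> verts G \<and> v \<in> verts G \<and> graph_dist G u v = enat k}\<rparr>"

text \<open>
  A cycle is a subgraph, identified with its edge set: the vertex lists that differ only by
  the choice of starting point or of orientation are one and the same cycle.
\<close>

definition cycle_edges :: "'a list \<Rightarrow> 'a set set" where
  "cycle_edges xs = set (map2 (\<lambda>u v. {u, v}) xs (rotate1 xs))"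

definition cycles :: "'a sgraph \<Rightarrow> nat \<Rightarrow> 'a set set set" where
  "cycles G j =
     {cycle_edges xs | xs. length xs = j \<and> 3 \<le> j \<and> distinct xs \<and> set xs \<subseteq> verts G \<and>
                           cycle_edges xs \<subseteq> edges G}"

definition num_cycles :: "'a sgraph \<Rightarrow> nat \<Rightarrow> nat" where
  "num_cycles G j = card (cycles G j)"

definition tree :: "'a sgraph \<Rightarrow> bool" where
  "tree G \<longleftrightarrow> simple_graph G \<and> verts G \<noteq> {} \<and> connected_graph G \<and> (\<forall>j. cycles G j = {})"

text \<open>
  Matrices indexed by a possibly infinite set. The product uses \<^const>\<open>infsum\<close>, since
  \<^const>\<open>sum\<close> over an infinite set is 0; for adjacency matrices of locally finite graphs only
  finitely many summands are nonzero.
\<close>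

definition index_mat_mult ::
    "'a set \<Rightarrow> ('a \<Rightarrow> 'a \<Rightarrow> real) \<Rightarrow> ('a \<Rightarrow> 'a \<Rightarrow> real) \<Rightarrow> 'a \<Rightarrow> 'a \<Rightarrow> real" where
  "index_mat_mult I A B = (\<lambda>u v. \<Sum>\<^sub>\<infinity>w\<in>I. A u w * B w v)"

primrec index_mat_pow :: "'a set \<Rightarrow> ('a \<Rightarrow> 'a \<Rightarrow> real) \<Rightarrow> nat \<Rightarrow> 'a \<Rightarrow> 'a \<Rightarrow> real" where
  "index_mat_pow I A 0 = (\<lambda>u v. if u = v then 1 else 0)"
| "index_mat_pow I A (Suc m) = index_mat_mult I A (index_mat_pow I A m)"

definition index_mat_trace :: "'a set \<Rightarrow> ('a \<Rightarrow> 'a \<Rightarrow> real) \<Rightarrow> real" where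
  "index_mat_trace I A = (\<Sum>u\<in>I. A u u)"

definition adj_matrix :: "'a sgraph \<Rightarrow> 'a \<Rightarrow> 'a \<Rightarrow> real" where
  "adj_matrix G = (\<lambda>u v. if adjacent G u v then 1 else 0)"

end

theory Submission
  imports Defs
begin

text \<open>
  Call a vertex function \<open>v\<close>-radial if it depends only on the distance to \<open>v\<close>. If every vertex \<open>u\<close>
  near \<open>v\<close> has, for every nearby \<open>w\<close>, at most one neighbour no farther from \<open>w\<close> than \<open>u\<close>
  is, then near \<open>v\<close> the distance-\<open>k\<close> matrix acts on \<open>v\<close>-radial functions by an operator
  determined by \<open>d\<close> and \<open>k\<close> alone, through a three-term recurrence in \<open>k\<close>. Applying it \<open>m\<close>
  times to the indicator of \<open>v\<close> shows that the diagonal entry of the \<open>m\<close>-th power at \<open>v\<close> is the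
  same number as at the root of the tree. When the condition fails at \<open>v\<close>, there is a short cycle
  within bounded distance of \<open>v\<close>, so the exceptional vertices are \<open>o(n)\<close> in number, and the
  diagonal entries there are bounded.
\<close>

section \<open>Walks and distances\<close>

lemma adjacent_sym: "adjacent G u v \<longleftrightarrow> adjacent G v u"
  by (simp add: adjacent_def insert_commute)

lemma adjacentD:
  assumes "simple_graph G" "adjacent G u v"
  shows "u \<in> verts G" "v \<in> verts G" "u \<noteq> v"
proof -
  have "{u, v} \<subseteq> verts G" "card {u, v} = 2"
    using assms by (auto simp: simple_graph_def adjacent_def)
  then show "u \<in> verts G" "v \<in> verts G" "u \<noteq> v" by auto
qed

lemma walk_rev: "walk G u p v \<Longrightarrow> walk G v (rev p) u"
  by (auto simp: walk_def hd_rev last_rev successively_rev adjacent_sym)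

lemma walk_append:
  assumes "walk G u p v" "walk G v q w"
  shows "walk G u (p @ tl q) w"
proof -
  obtain q' where q: "q = v # q'" using assms(2) by (cases q) (auto simp: walk_def)
  show ?thesis
    using assms unfolding q walk_def
    by (cases q') (auto simp: successively_append_iff)
qed

lemma walk_single: "u \<in> verts G \<Longrightarrow> walk G u [u] u"
  by (simp add: walk_def)

lemma walk_adjacent: "simple_graph G \<Longrightarrow> adjacent G u v \<Longrightarrow> walk G u [u, v] v"
  by (auto simp: walk_def dest: adjacentD)

lemma walk_in_verts: "walk G u p v \<Longrightarrow> u \<in> verts G \<and> v \<in> verts G"
  unfolding walk_def using hd_in_set last_in_set by blast

lemma walk_prefix: "walk G u (q @ z # s) v \<Longrightarrow> walk G u (q @ [z]) z"
proof -
  assume "walk G u (q @ z # s) v"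
  then have "walk G u ((q @ [z]) @ s) v" by simp
  then show ?thesis unfolding walk_def successively_append_iff by (cases q) auto
qed

lemma walk_suffix: "walk G u (q @ z # s) v \<Longrightarrow> walk G z (z # s) v"
  by (auto simp: walk_def successively_append_iff)

lemma graph_dist_le_walk: "walk G u p v \<Longrightarrow> graph_dist G u v \<le> enat (length p - 1)"
  unfolding graph_dist_def by (rule INF_lower) simp

text \<open>A finite distance rules out the empty set of walks, whose infimum is infinity, and a
  nonempty infimum in the well-order \<open>enat\<close> is attained.\<close>

lemma graph_dist_walk:
  assumes "graph_dist G u v = enat n"
  obtains p where "walk G u p v" "length p = Suc n"
proof -
  let ?S = "(\<lambda>p. enat (length p - 1)) ` {p. walk G u p v}"
  have "?S \<noteq> {}"
  proof
    assume "?S = {}"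
    then have "graph_dist G u v = \<infinity>"
      unfolding graph_dist_def by (simp add: Inf_enat_def)
    then show False using assms by simp
  qed
  then have "Inf ?S \<in> ?S" by (metis ex_in_conv wellorder_InfI)
  then obtain p where p: "walk G u p v" "graph_dist G u v = enat (length p - 1)"
    unfolding graph_dist_def by auto
  then have "length p = Suc n" using assms by (cases p) (auto simp: walk_def)
  then show thesis using p(1) that by blast
qed

lemma graph_dist_verts: "graph_dist G u v = enat n \<Longrightarrow> u \<in> verts G \<and> v \<in> verts G"
  by (metis graph_dist_walk walk_in_verts)

lemma graph_dist_sym: "graph_dist G u v = graph_dist G v u"
proof -
  have "graph_dist G u v \<le> graph_dist G v u" for u v
  proof (cases "graph_dist G v u")
    case (enat n)
    then obtain p where "walk G v p u" "length p = Suc n" by (rule graph_dist_walk)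
    then show ?thesis using graph_dist_le_walk[OF walk_rev] enat by fastforce
  qed simp
  then show ?thesis by (meson antisym)
qed

lemma graph_dist_triangle: "graph_dist G u w \<le> graph_dist G u v + graph_dist G v w"
proof (cases "graph_dist G u v")
  case [simp]: (enat m)
  show ?thesis
  proof (cases "graph_dist G v w")
    case [simp]: (enat n)
    obtain p q where p: "walk G u p v" "length p = Suc m" and q: "walk G v q w" "length q = Suc n"
      by (metis enat \<open>graph_dist G u v = enat m\<close> graph_dist_walk)
    show ?thesis using graph_dist_le_walk[OF walk_append[OF p(1) q(1)]] p(2) q(2) by simp
  qed simp
qed simp

lemma graph_dist_refl: "u \<in> verts G \<Longrightarrow> graph_dist G u u = 0"
  using graph_dist_le_walk[OF walk_single, of u G] by (simp add: zero_enat_def[symmetric])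

lemma graph_dist_eq_0: "graph_dist G u v = 0 \<longleftrightarrow> u = v \<and> u \<in> verts G"
proof
  assume "graph_dist G u v = 0"
  then obtain p where "walk G u p v" "length p = Suc 0"
    unfolding zero_enat_def by (rule graph_dist_walk)
  then show "u = v \<and> u \<in> verts G" by (cases p) (auto simp: walk_def)
qed (use graph_dist_refl in auto)

lemma graph_dist_adjacent:
  assumes "simple_graph G" "adjacent G u x"
  shows "graph_dist G u x = 1"
proof -
  have "graph_dist G u x \<le> 1"
    using graph_dist_le_walk[OF walk_adjacent[OF assms]] by (simp add: one_enat_def)
  moreover have "graph_dist G u x \<noteq> 0"
    using adjacentD[OF assms] by (simp add: graph_dist_eq_0)
  ultimately show ?thesis by (cases "graph_dist G u x") (auto simp: one_enat_def zero_enat_def)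
qed

lemma graph_dist_neighbour_le:
  assumes "simple_graph G" "adjacent G u x"
  shows "graph_dist G w x \<le> graph_dist G w u + 1"
  using graph_dist_triangle[of G w x u] graph_dist_adjacent[OF assms] by simp

text \<open>Take the second vertex of a shortest walk from \<open>u\<close> to \<open>w\<close>. The
  rest of that walk bounds its distance from above; adjacency to \<open>u\<close> bounds it from
  below.\<close>

lemma graph_dist_Suc_neighbour:
  assumes "simple_graph G" "graph_dist G w u = enat (Suc n)"
  obtains x where "adjacent G u x" "graph_dist G w x = enat n"
proof -
  obtain p where p: "walk G u p w" "length p = Suc (Suc n)"
    using assms(2) graph_dist_sym graph_dist_walk by metis
  then obtain x q where pq: "p = u # x # q"
    by (cases p; cases "tl p") (auto simp: walk_def)
  have ux: "adjacent G u x" using p by (auto simp: pq walk_def)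
  have "walk G x (x # q) w" using walk_suffix[of G u "[u]" x q w] p by (simp add: pq)
  then have "graph_dist G w x \<le> enat n"
    using graph_dist_le_walk[of G x "x # q" w] p(2) by (simp add: pq graph_dist_sym)
  moreover have "enat (Suc n) \<le> graph_dist G w x + 1"
    using graph_dist_neighbour_le[of G x u w] assms ux adjacent_sym by metis
  ultimately have "graph_dist G w x = enat n"
    by (cases "graph_dist G w x") (auto simp: one_enat_def)
  then show thesis using that ux by blast
qed

section \<open>Unique descent and short cycles\<close>

text \<open>The non-strict comparison also excludes a neighbour at the same distance from
  \<open>w\<close> as \<open>u\<close>, hence odd cycles: for \<open>w\<close> at finite positive
  distance a strictly closer neighbour already exists.\<close>

definition unique_descent :: "'a sgraph \<Rightarrow> 'a \<Rightarrow> 'a \<Rightarrow> bool" where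
  "unique_descent G w u \<longleftrightarrow>
     (\<forall>x\<in>neighbours G u. \<forall>y\<in>neighbours G u.
        graph_dist G w x \<le> graph_dist G w u \<longrightarrow> graph_dist G w y \<le> graph_dist G w u \<longrightarrow> x = y)"

text \<open>For \<open>b = a\<close> this zip is the one in \<open>cycle_edges (a # p)\<close>,
  since \<open>rotate1\<close> turns \<open>a # p\<close> into \<open>p @ [a]\<close>.\<close>

lemma successively_zip_adjacent:
  "successively P (a # p @ [b]) \<Longrightarrow> (s, t) \<in> set (zip (a # p) (p @ [b])) \<Longrightarrow> P s t"
  by (induction p arbitrary: a) auto

text \<open>A shortest walk to \<open>x\<close> has at most \<open>a\<close> steps, and reaching
  \<open>u\<close> already takes \<open>a\<close> steps. So \<open>u\<close> could only be its last
  vertex, which is \<open>x\<close>.\<close>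

lemma walk_near_avoids:
  assumes "graph_dist G w u = enat a" "graph_dist G w x \<le> enat a" "x \<noteq> u"
  obtains p where "walk G w p x" "u \<notin> set p" "length p \<le> Suc a"
proof -
  obtain n where n: "graph_dist G w x = enat n" "n \<le> a"
    using assms(2) by (cases "graph_dist G w x") auto
  obtain p where p: "walk G w p x" "length p = Suc n" using n(1) by (rule graph_dist_walk)
  have "u \<notin> set p"
  proof
    assume "u \<in> set p"
    then obtain q s where qs: "p = q @ u # s" by (meson split_list)
    have "enat a \<le> enat (length q)"
      using graph_dist_le_walk[OF walk_prefix] p(1) assms(1) unfolding qs by fastforce
    moreover have "length p = length q + Suc (length s)" by (simp add: qs)
    ultimately have "length s \<le> 0" using p(2) n(2) by (simp only: enat_ord_simps)
    then have "s = []" by simp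
    then show False using p(1) assms(3) qs by (simp add: walk_def)
  qed
  then show thesis using that p n by simp
qed

text \<open>Two neighbours violating uniqueness are joined through \<open>w\<close> by a walk that
  avoids \<open>u\<close>. A shortest such walk is a path, and \<open>u\<close> closes it to a
  cycle.\<close>

lemma short_cycle_if_not_unique_descent:
  assumes G: "simple_graph G" and wu: "graph_dist G w u = enat a" and "\<not> unique_descent G w u"
  shows "\<exists>j C. 3 \<le> j \<and> j \<le> 2 * a + 2 \<and> C \<in> cycles G j \<and> u \<in> \<Union>C"
proof -
  obtain x y where x: "x \<in> neighbours G u" "graph_dist G w x \<le> enat a"
    and y: "y \<in> neighbours G u" "graph_dist G w y \<le> enat a" and xy: "x \<noteq> y"
    using assms unfolding unique_descent_def by auto
  have ux: "adjacent G u x" and uy: "adjacent G u y" using x y by (auto simp: neighbours_def)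
  have ne: "x \<noteq> u" "y \<noteq> u" using adjacentD(3)[OF G ux] adjacentD(3)[OF G uy] by auto
  obtain p where p: "walk G w p x" "u \<notin> set p" "length p \<le> Suc a"
    using walk_near_avoids wu x(2) ne(1) by metis
  obtain q where q: "walk G w q y" "u \<notin> set q" "length q \<le> Suc a"
    using walk_near_avoids wu y(2) ne(2) by metis
  define Q where "Q c \<longleftrightarrow> walk G x c y \<and> u \<notin> set c" for c
  have "Q (rev p @ tl q)"
    unfolding Q_def using walk_append[OF walk_rev[OF p(1)] q(1)] p q
    by (cases q) auto
  \<comment> \<open>Each half has at most \<open>a + 1\<close> vertices and they share
    \<open>w\<close>; adding \<open>u\<close> later gives the bound
    \<open>2 * a + 2\<close>.\<close>
  moreover have "length (rev p @ tl q) \<le> 2 * a + 1" using p(3) q(3) by simp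
  moreover define c where "c = arg_min length Q"
  ultimately have c: "Q c" "length c \<le> 2 * a + 1" and cmin: "\<And>c'. Q c' \<Longrightarrow> length c \<le> length c'"
    by (auto intro: arg_min_natI arg_min_nat_le order_trans)
  have cw: "walk G x c y" "u \<notin> set c" using c(1) by (auto simp: Q_def)
  have "distinct c"
  proof (rule ccontr)
    assume "\<not> distinct c"
    then obtain xs ys zs z where d: "c = xs @ [z] @ ys @ [z] @ zs"
      using not_distinct_decomp by blast
    \<comment> \<open>Cutting out the closed part between the two visits to \<open>z\<close> leaves
      a shorter walk that still avoids \<open>u\<close>.\<close>
    have "walk G x (xs @ [z]) z" using walk_prefix cw(1) unfolding d by fastforce
    moreover have "walk G z (z # zs) y"
      using walk_suffix[of G x "xs @ z # ys" z zs y] cw(1) unfolding d by simp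
    ultimately have "walk G x ((xs @ [z]) @ tl (z # zs)) y" by (rule walk_append)
    then have "Q (xs @ z # zs)" using cw(2) by (simp add: Q_def d)
    then show False using cmin d by fastforce
  qed
  have succ: "successively (adjacent G) (u # c @ [u])"
    using cw(1) ux uy adjacent_sym[of G u y]
    by (simp add: walk_def successively_append_iff successively_Cons)
  have sub: "cycle_edges (u # c) \<subseteq> edges G"
    using successively_zip_adjacent[OF succ]
    by (auto simp: cycle_edges_def adjacent_def simp del: zip_Cons_Cons)
  have "length c \<ge> 2"
    using cw(1) xy by (cases c; cases "tl c") (auto simp: walk_def)
  moreover have "set (u # c) \<subseteq> verts G" using cw(1) adjacentD[OF G ux] by (auto simp: walk_def)
  ultimately have "cycle_edges (u # c) \<in> cycles G (Suc (length c))"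
    unfolding cycles_def using sub cw(2) \<open>distinct c\<close> by fastforce
  moreover have "u \<in> \<Union>(cycle_edges (u # c))"
    unfolding cycle_edges_def by (cases c) auto
  ultimately show ?thesis using c(2) \<open>length c \<ge> 2\<close>
    by (intro exI[of _ "Suc (length c)"] exI[of _ "cycle_edges (u # c)"]) auto
qed

section \<open>Sums over spheres\<close>

definition sphere_set :: "'a sgraph \<Rightarrow> nat \<Rightarrow> 'a \<Rightarrow> 'a set" where
  "sphere_set G k u = {w. graph_dist G u w = enat k}"

definition ball_set :: "'a sgraph \<Rightarrow> nat \<Rightarrow> 'a \<Rightarrow> 'a set" where
  "ball_set G k u = {w. graph_dist G u w \<le> enat k}"

text \<open>The adjacency operator of the \<open>d\<close>-regular tree on radial functions: a
  vertex at positive distance has one neighbour nearer the centre and \<open>d - 1\<close> farther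
  away.\<close>

definition radial_step :: "nat \<Rightarrow> (nat \<Rightarrow> real) \<Rightarrow> nat \<Rightarrow> real" where
  "radial_step d h a = (if a = 0 then real d * h 1 else h (a - 1) + (real d - 1) * h (a + 1))"

text \<open>Applies to \<open>radial_step\<close> the polynomial that expresses the
  distance-\<open>k\<close> matrix of the \<open>d\<close>-regular tree through its adjacency
  matrix. The case \<open>k = 0\<close> of the coefficient counts the \<open>d\<close> ways to step
  out and straight back.\<close>

fun radial_op :: "nat \<Rightarrow> nat \<Rightarrow> (nat \<Rightarrow> real) \<Rightarrow> nat \<Rightarrow> real" where
  "radial_op d 0 h = h"
| "radial_op d (Suc 0) h = radial_step d h"
| "radial_op d (Suc (Suc k)) h =
     (\<lambda>a. radial_step d (radial_op d (Suc k) h) a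
          - (if k = 0 then real d else real d - 1) * radial_op d k h a)"

locale regular_sgraph =
  fixes G :: "'a sgraph" and d :: nat
  assumes simple: "simple_graph G" and regular: "regular_graph d G"
begin

abbreviation dist_G ("\<delta>") where "dist_G \<equiv> graph_dist G"

lemma neighbours_iff: "x \<in> neighbours G u \<longleftrightarrow> adjacent G u x"
  using adjacentD[OF simple] by (auto simp: neighbours_def)

lemma finite_neighbours: "u \<in> verts G \<Longrightarrow> finite (neighbours G u)"
  and card_neighbours: "u \<in> verts G \<Longrightarrow> card (neighbours G u) = d"
  using regular by (auto simp: regular_graph_def)

text \<open>A ball of radius \<open>n + 1\<close> is covered by the balls of radius \<open>n\<close>
  about \<open>u\<close> and its neighbours, at most \<open>d + 1\<close> centres. No tree-likeness
  enters, so the bound serves exceptional vertices too.\<close>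

lemma ball_set_bound: "u \<in> verts G \<Longrightarrow> finite (ball_set G n u) \<and> card (ball_set G n u) \<le> (d + 1) ^ n"
proof (induction n arbitrary: u)
  case 0
  have "ball_set G 0 u = {u}"
    using 0 by (auto simp: ball_set_def graph_dist_eq_0 zero_enat_def[symmetric])
  then show ?case by simp
next
  case (Suc n)
  let ?N = "insert u (neighbours G u)"
  have sub: "ball_set G (Suc n) u \<subseteq> (\<Union>x\<in>?N. ball_set G n x)"
  proof
    fix w assume w: "w \<in> ball_set G (Suc n) u"
    show "w \<in> (\<Union>x\<in>?N. ball_set G n x)"
    proof (cases "\<delta> u w = enat (Suc n)")
      case True
      then obtain x where "adjacent G u x" "\<delta> w x = enat n"
        using graph_dist_Suc_neighbour[OF simple] graph_dist_sym by metis
      then have "x \<in> ?N" "w \<in> ball_set G n x"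
        by (auto simp: neighbours_iff ball_set_def graph_dist_sym[of G x w])
      then show ?thesis by blast
    next
      case False
      then have "\<delta> u w \<le> enat n" using w by (cases "\<delta> u w") (auto simp: ball_set_def)
      then show ?thesis by (auto simp: ball_set_def)
    qed
  qed
  have N: "finite ?N" "card ?N \<le> d + 1"
    using finite_neighbours[OF Suc.prems] card_neighbours[OF Suc.prems]
    by (auto simp: card_insert_if)
  have IH: "finite (ball_set G n x) \<and> card (ball_set G n x) \<le> (d + 1) ^ n" if "x \<in> ?N" for x
    using that Suc adjacentD[OF simple] by (auto simp: neighbours_iff)
  have fin: "finite (\<Union>x\<in>?N. ball_set G n x)" using N IH by blast
  have "card (ball_set G (Suc n) u) \<le> card (\<Union>x\<in>?N. ball_set G n x)"
    using sub fin by (rule card_mono[rotated])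
  also have "\<dots> \<le> (\<Sum>x\<in>?N. card (ball_set G n x))" using N by (intro card_UN_le)
  also have "\<dots> \<le> card ?N * (d + 1) ^ n"
    using sum_bounded_above[of ?N "\<lambda>x. card (ball_set G n x)" "(d + 1) ^ n"] IH by simp
  also have "\<dots> \<le> (d + 1) * (d + 1) ^ n" using N by (intro mult_right_mono) auto
  finally show ?case using sub fin finite_subset by auto
qed

lemma sphere_subset_ball: "sphere_set G n u \<subseteq> ball_set G n u"
  by (auto simp: sphere_set_def ball_set_def)

lemma finite_sphere_set: "u \<in> verts G \<Longrightarrow> finite (sphere_set G n u)"
  by (rule finite_subset[OF sphere_subset_ball]) (simp add: ball_set_bound)

lemma card_sphere_set_le: "u \<in> verts G \<Longrightarrow> card (sphere_set G n u) \<le> (d + 1) ^ n"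
  using ball_set_bound[of u n] card_mono[OF _ sphere_subset_ball[of n u]] by linarith

section \<open>Radial functions under unique descent\<close>

lemma neighbours_0:
  assumes "\<delta> w u = 0" "x \<in> neighbours G u"
  shows "\<delta> w x = enat 1"
  using assms graph_dist_adjacent[OF simple]
  by (auto simp: graph_dist_eq_0 neighbours_iff one_enat_def)

lemma unique_descent_neighbours:
  assumes "unique_descent G w u" "\<delta> w u = enat (Suc a)"
  obtains x where "x \<in> neighbours G u" "\<delta> w x = enat a"
    "\<And>y. y \<in> neighbours G u - {x} \<Longrightarrow> \<delta> w y = enat (Suc (Suc a))"
proof -
  obtain x where x: "adjacent G u x" "\<delta> w x = enat a"
    using graph_dist_Suc_neighbour[OF simple assms(2)] by metis
  have "\<delta> w y = enat (Suc (Suc a))" if y: "y \<in> neighbours G u - {x}" for y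
  proof -
    have "\<not> \<delta> w y \<le> enat (Suc a)"
      using assms x y unfolding unique_descent_def neighbours_iff[symmetric] by force
    moreover have "\<delta> w y \<le> enat (Suc a) + 1"
      using graph_dist_neighbour_le[OF simple, of u y w] y assms(2) by (simp add: neighbours_iff)
    ultimately show ?thesis by (cases "\<delta> w y") (auto simp: one_enat_def)
  qed
  then show thesis using that x by (simp add: neighbours_iff)
qed

lemma sum_neighbours_radial:
  assumes "unique_descent G w u" "\<delta> w u = enat a"
  shows "(\<Sum>x\<in>neighbours G u. h (the_enat (\<delta> w x))) = radial_step d h a"
proof -
  have u: "u \<in> verts G" using assms(2) graph_dist_verts by metis
  show ?thesis
  proof (cases a)
    case 0
    then have "(\<Sum>x\<in>neighbours G u. h (the_enat (\<delta> w x))) = (\<Sum>x\<in>neighbours G u. h 1)"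
      using neighbours_0 assms(2) by (intro sum.cong) (auto simp: zero_enat_def)
    then show ?thesis using 0 card_neighbours[OF u] by (simp add: radial_step_def)
  next
    case (Suc b)
    obtain x where x: "x \<in> neighbours G u" "\<delta> w x = enat b"
      "\<And>y. y \<in> neighbours G u - {x} \<Longrightarrow> \<delta> w y = enat (Suc (Suc b))"
      using unique_descent_neighbours assms Suc by metis
    have "card (neighbours G u) \<ge> 1"
      using x(1) finite_neighbours[OF u] by (metis One_nat_def Suc_leI card_gt_0_iff empty_iff)
    then have "real (card (neighbours G u - {x})) = real d - 1"
      using x(1) finite_neighbours[OF u] card_neighbours[OF u] by (simp add: of_nat_diff)
    moreover have "(\<Sum>y\<in>neighbours G u - {x}. h (the_enat (\<delta> w y)))
        = (\<Sum>y\<in>neighbours G u - {x}. h (Suc (Suc b)))"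
      using x(3) by (intro sum.cong) auto
    ultimately show ?thesis
      using x finite_neighbours[OF u] Suc
      by (simp add: radial_step_def sum.remove[of _ x])
  qed
qed

text \<open>The count is a neighbour sum of a radial indicator. Descent is assumed only up to
  distance \<open>k + 2\<close> because beyond it no neighbour of \<open>u\<close> can lie at
  distance \<open>k + 1\<close> from \<open>w\<close>.\<close>

lemma card_neighbours_at_dist:
  assumes "u \<in> verts G" and ud: "\<delta> w u \<le> enat (Suc (Suc k)) \<Longrightarrow> unique_descent G w u"
  shows "real (card {x \<in> neighbours G u. \<delta> w x = enat (Suc k)}) =
    (if \<delta> w u = enat (Suc (Suc k)) then 1 else 0) +
    (if \<delta> w u = enat k then if k = 0 then real d else real d - 1 else 0)"
proof (cases "\<delta> w u \<le> enat (Suc (Suc k))")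
  case False
  have "\<not> \<delta> w x = enat (Suc k)" if "x \<in> neighbours G u" for x
    using graph_dist_neighbour_le[OF simple, of x u w] that False
    by (auto simp: neighbours_iff adjacent_sym one_enat_def)
  then have none: "{x \<in> neighbours G u. \<delta> w x = enat (Suc k)} = {}" by auto
  show ?thesis unfolding none using False by auto
next
  case True
  then obtain a where a: "\<delta> w u = enat a" "a \<le> Suc (Suc k)" by (cases "\<delta> w u") auto
  have fin: "finite (neighbours G u)" by (rule finite_neighbours) fact
  have "real (card {x \<in> neighbours G u. \<delta> w x = enat (Suc k)}) =
      (\<Sum>x\<in>neighbours G u. if \<delta> w x = enat (Suc k) then 1 else 0)"
    using fin by (simp add: sum.If_cases Int_def)
  \<comment> \<open>Passing to \<open>the_enat\<close> is sound only because these distances are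
    finite; its value at infinity is unspecified.\<close>
  also have "\<dots> = (\<Sum>x\<in>neighbours G u. if the_enat (\<delta> w x) = Suc k then 1 else 0)"
  proof (intro sum.cong refl)
    fix x assume "x \<in> neighbours G u"
    then have "\<delta> w x \<le> enat a + 1"
      using graph_dist_neighbour_le[OF simple, of u x w] a by (simp add: neighbours_iff)
    then show "(if \<delta> w x = enat (Suc k) then 1 else 0 :: real)
        = (if the_enat (\<delta> w x) = Suc k then 1 else 0)"
      by (cases "\<delta> w x") (auto simp: one_enat_def)
  qed
  also have "\<dots> = radial_step d (\<lambda>j. if j = Suc k then 1 else 0) a"
    using sum_neighbours_radial[OF ud[OF True] a(1), of "\<lambda>j. if j = Suc k then 1 else 0"] .
  \<comment> \<open>The first summand is the single nearer neighbour when \<open>a = k + 2\<close>;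
    the second counts the farther ones when \<open>a = k\<close>, all \<open>d\<close> of them at
    the centre.\<close>
  also have "\<dots> = (if \<delta> w u = enat (Suc (Suc k)) then 1 else 0) +
    (if \<delta> w u = enat k then if k = 0 then real d else real d - 1 else 0)"
    unfolding a radial_step_def by auto
  finally show ?thesis .
qed

text \<open>This is the identity \<open>A A\<^sub>k\<^sub>+\<^sub>1 = A\<^sub>k\<^sub>+\<^sub>2 + c\<^sub>k A\<^sub>k\<close> for the distance matrices of a tree,
  with \<open>c\<^sub>0 = d\<close> and \<open>c\<^sub>k = d - 1\<close> otherwise, read off in the row of \<open>u\<close>.\<close>

lemma sum_neighbours_sphere:
  fixes \<phi> :: "'a \<Rightarrow> real"
  assumes u: "u \<in> verts G"
    and ud: "\<And>w. \<delta> w u \<le> enat (Suc (Suc k)) \<Longrightarrow> unique_descent G w u"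
  shows "(\<Sum>x\<in>neighbours G u. \<Sum>w\<in>sphere_set G (Suc k) x. \<phi> w) =
    (\<Sum>w\<in>sphere_set G (Suc (Suc k)) u. \<phi> w)
    + (if k = 0 then real d else real d - 1) * (\<Sum>w\<in>sphere_set G k u. \<phi> w)"
proof -
  let ?c = "if k = 0 then real d else real d - 1"
  let ?N = "neighbours G u"
  \<comment> \<open>A common finite index set for all the spheres, so that the two sums can be
    exchanged and each \<open>w\<close> weighted by a neighbour count.\<close>
  define W where "W = (\<Union>x\<in>?N. sphere_set G (Suc k) x) \<union> sphere_set G (Suc (Suc k)) u \<union> sphere_set G k u"
  have finN: "finite ?N" using u by (rule finite_neighbours)
  have W: "finite W"
    unfolding W_def using finN finite_sphere_set u adjacentD[OF simple] neighbours_iff by blast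
  have restrict: "(\<Sum>w\<in>sphere_set G j x. \<phi> w) = (\<Sum>w\<in>W. if \<delta> w x = enat j then \<phi> w else 0)"
    if "sphere_set G j x \<subseteq> W" for j x
  proof -
    have "sphere_set G j x = {w \<in> W. \<delta> w x = enat j}"
      using that by (auto simp: sphere_set_def graph_dist_sym)
    then show ?thesis using W by (simp add: sum.inter_filter)
  qed
  have "(\<Sum>x\<in>?N. \<Sum>w\<in>sphere_set G (Suc k) x. \<phi> w)
      = (\<Sum>x\<in>?N. \<Sum>w\<in>W. if \<delta> w x = enat (Suc k) then \<phi> w else 0)"
    by (intro sum.cong refl restrict) (auto simp: W_def)
  also have "\<dots> = (\<Sum>w\<in>W. \<Sum>x\<in>?N. if \<delta> w x = enat (Suc k) then \<phi> w else 0)"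
    by (rule sum.swap)
  also have "\<dots> = (\<Sum>w\<in>W. real (card {x \<in> ?N. \<delta> w x = enat (Suc k)}) * \<phi> w)"
    using finN by (simp add: sum.inter_filter[symmetric])
  also have "\<dots> = (\<Sum>w\<in>W. (if \<delta> w u = enat (Suc (Suc k)) then \<phi> w else 0)
      + ?c * (if \<delta> w u = enat k then \<phi> w else 0))"
    by (intro sum.cong refl) (subst card_neighbours_at_dist[OF u ud], auto)
  also have "\<dots> = (\<Sum>w\<in>sphere_set G (Suc (Suc k)) u. \<phi> w) + ?c * (\<Sum>w\<in>sphere_set G k u. \<phi> w)"
    by (subst (1 2) restrict) (auto simp: W_def sum.distrib sum_distrib_left)
  finally show ?thesis .
qed

text \<open>The case \<open>w = v\<close> lets neighbour sums preserve radial functions about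
  \<open>v\<close>; the other \<open>w\<close> give the recurrence for spheres about
  \<open>u\<close>.\<close>

definition tree_like :: "nat \<Rightarrow> 'a \<Rightarrow> bool" where
  "tree_like R v \<longleftrightarrow> (\<forall>u w. \<delta> v u \<le> enat R \<longrightarrow> \<delta> w u \<le> enat R \<longrightarrow> unique_descent G w u)"

lemma sphere_set_0: "u \<in> verts G \<Longrightarrow> sphere_set G 0 u = {u}"
  by (auto simp: sphere_set_def graph_dist_eq_0 zero_enat_def[symmetric])

lemma sphere_set_1: "u \<in> verts G \<Longrightarrow> sphere_set G (Suc 0) u = neighbours G u"
proof (intro equalityI subsetI)
  fix x assume "x \<in> sphere_set G (Suc 0) u"
  then have "\<delta> u x = enat (Suc 0)" by (simp add: sphere_set_def)
  then obtain y where "adjacent G x y" "\<delta> u y = enat 0"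
    using graph_dist_Suc_neighbour[OF simple] by metis
  then show "x \<in> neighbours G u"
    by (simp add: zero_enat_def[symmetric] graph_dist_eq_0 neighbours_iff adjacent_sym)
qed (auto simp: sphere_set_def neighbours_iff graph_dist_adjacent[OF simple] one_enat_def)

text \<open>Passing to a neighbour of \<open>u\<close> raises \<open>a\<close> by at most one while
  the sphere radius drops by one, so \<open>a + k\<close> stays within \<open>R\<close>. The sphere
  recurrence then matches that of \<open>radial_op\<close>.\<close>

lemma sum_sphere_radial:
  assumes "tree_like R v" "\<delta> v u = enat a" "a + k \<le> R"
  shows "(\<Sum>w\<in>sphere_set G k u. h (the_enat (\<delta> v w))) = radial_op d k h a"
  using assms(2,3)
proof (induction k arbitrary: a u rule: induct_nat_012)
  case 0
  then show ?case using graph_dist_verts[OF 0(1)] by (simp add: sphere_set_0)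
next
  case 1
  then have "unique_descent G v u" using assms(1) by (simp add: tree_like_def)
  then show ?case
    using sum_neighbours_radial 1 graph_dist_verts[OF 1(1)] by (simp add: sphere_set_1)
next
  case (ge2 k)
  have u: "u \<in> verts G" using graph_dist_verts[OF ge2.prems(1)] by simp
  have ud: "unique_descent G w u" if "\<delta> w u \<le> enat (Suc (Suc k))" for w
  proof -
    have "\<delta> w u \<le> enat R"
      using that ge2.prems(2) by (meson enat_ord_simps(1) le_trans order_trans trans_le_add2 le_add2)
    then show ?thesis using assms(1) ge2.prems by (simp add: tree_like_def)
  qed
  let ?\<phi> = "\<lambda>w. h (the_enat (\<delta> v w))"
  have "(\<Sum>w\<in>sphere_set G (Suc k) x. ?\<phi> w) = radial_op d (Suc k) h (the_enat (\<delta> v x))"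
    if "x \<in> neighbours G u" for x
  proof -
    have "\<delta> v x \<le> enat a + 1"
      using graph_dist_neighbour_le[OF simple, of u x v] that ge2.prems(1) by (simp add: neighbours_iff)
    then obtain b where "\<delta> v x = enat b" "b \<le> Suc a"
      by (cases "\<delta> v x") (auto simp: one_enat_def)
    then show ?thesis using ge2.IH(2)[of x b] ge2.prems(2) by simp
  qed
  then have "(\<Sum>x\<in>neighbours G u. \<Sum>w\<in>sphere_set G (Suc k) x. ?\<phi> w)
      = (\<Sum>x\<in>neighbours G u. radial_op d (Suc k) h (the_enat (\<delta> v x)))"
    by (intro sum.cong) auto
  also have "\<dots> = radial_step d (radial_op d (Suc k) h) a"
  proof (rule sum_neighbours_radial)
    show "unique_descent G v u" using assms(1) ge2.prems by (simp add: tree_like_def)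
  qed fact
  finally show ?case
    using sum_neighbours_sphere[OF u ud, of k ?\<phi>] ge2.IH(1)[OF ge2.prems(1)] ge2.prems(2)
    by simp
qed

section \<open>Powers of the distance matrix\<close>

lemma adj_matrix_distance_graph:
  "adj_matrix (distance_graph k G) u w = (if w \<in> sphere_set G k u then 1 else 0)"
proof -
  have "adjacent (distance_graph k G) u w \<longleftrightarrow> \<delta> u w = enat k"
    using graph_dist_verts[of G u w k] graph_dist_sym[of G u w]
    by (auto simp: adjacent_def distance_graph_def doubleton_eq_iff)
  then show ?thesis by (simp add: adj_matrix_def sphere_set_def)
qed

abbreviation distance_pow :: "nat \<Rightarrow> nat \<Rightarrow> 'a \<Rightarrow> 'a \<Rightarrow> real" where
  "distance_pow k \<equiv> index_mat_pow (verts G) (adj_matrix (distance_graph k G))"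

lemma distance_pow_Suc:
  assumes "u \<in> verts G"
  shows "distance_pow k (Suc m) u v = (\<Sum>w\<in>sphere_set G k u. distance_pow k m w v)"
proof -
  have "distance_pow k (Suc m) u v
      = (\<Sum>\<^sub>\<infinity>w\<in>verts G. adj_matrix (distance_graph k G) u w * distance_pow k m w v)"
    by (simp add: index_mat_mult_def)
  also have "\<dots> = (\<Sum>\<^sub>\<infinity>w\<in>sphere_set G k u. distance_pow k m w v)"
    \<comment> \<open>Terms outside the sphere vanish, so the infinite sum becomes a finite
      one.\<close>
    using graph_dist_verts[of G u]
    by (intro infsum_cong_neutral) (auto simp: adj_matrix_distance_graph sphere_set_def)
  finally show ?thesis using finite_sphere_set[OF assms] by simp
qed

text \<open>Column \<open>v\<close> of the power starts as the indicator of \<open>v\<close> and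
  stays radial. Each factor looks at most \<open>k\<close> farther out, which gives the budget
  \<open>a + m * k\<close>.\<close>

lemma distance_pow_radial:
  assumes "tree_like R v" "\<delta> v u = enat a" "a + m * k \<le> R"
  shows "distance_pow k m u v = (radial_op d k ^^ m) (\<lambda>a. if a = 0 then 1 else 0) a"
  using assms(2,3)
proof (induction m arbitrary: u a)
  case 0
  then show ?case
    using graph_dist_eq_0[of G v u] graph_dist_verts[OF 0(1)] by (auto simp: zero_enat_def)
next
  case (Suc m)
  have u: "u \<in> verts G" using graph_dist_verts[OF Suc.prems(1)] by simp
  let ?h = "(radial_op d k ^^ m) (\<lambda>a. if a = 0 then 1 else 0)"
  have "distance_pow k m w v = ?h (the_enat (\<delta> v w))" if "w \<in> sphere_set G k u" for w
  proof -
    have "\<delta> v w \<le> enat (a + k)"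
      using graph_dist_triangle[of G v w u] Suc.prems(1) that by (simp add: sphere_set_def)
    then obtain b where "\<delta> v w = enat b" "b \<le> a + k" by (cases "\<delta> v w") auto
    then show ?thesis using Suc.IH[of w b] Suc.prems(2) by simp
  qed
  then have "distance_pow k (Suc m) u v = (\<Sum>w\<in>sphere_set G k u. ?h (the_enat (\<delta> v w)))"
    unfolding distance_pow_Suc[OF u] by (intro sum.cong) auto
  also have "\<dots> = radial_op d k ?h a"
    using assms(1) Suc.prems by (intro sum_sphere_radial) auto
  finally show ?case by simp
qed

text \<open>Each row of the distance matrix sums to at most \<open>(d + 1) ^ k\<close>. This
  controls the diagonal entries at vertices that are not tree-like.\<close>

lemma distance_pow_bounds:
  assumes "u \<in> verts G"
  shows "0 \<le> distance_pow k m u v \<and> distance_pow k m u v \<le> (real (d + 1) ^ k) ^ m"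
  using assms
proof (induction m arbitrary: u)
  case (Suc m)
  have IH: "0 \<le> distance_pow k m w v" "distance_pow k m w v \<le> (real (d + 1) ^ k) ^ m"
    if "w \<in> sphere_set G k u" for w
    using that Suc.IH graph_dist_verts[of G u w k] by (auto simp: sphere_set_def)
  have "(\<Sum>w\<in>sphere_set G k u. distance_pow k m w v)
      \<le> real (card (sphere_set G k u)) * (real (d + 1) ^ k) ^ m"
    using IH(2) by (intro sum_bounded_above) auto
  also have "\<dots> \<le> real (d + 1) ^ k * (real (d + 1) ^ k) ^ m"
  proof (rule mult_right_mono)
    show "real (card (sphere_set G k u)) \<le> real (d + 1) ^ k"
      using card_sphere_set_le[OF Suc.prems, of k] by (metis of_nat_le_iff of_nat_power)
  qed simp
  finally show ?case
    using IH(1) unfolding distance_pow_Suc[OF Suc.prems] by (auto intro: sum_nonneg)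
qed simp

section \<open>Exceptional vertices and the trace error\<close>

lemma tree_like_if_no_cycles: "(\<And>j. cycles G j = {}) \<Longrightarrow> tree_like R v"
  unfolding tree_like_def
proof (intro allI impI)
  fix u w assume "\<And>j. cycles G j = {}" "\<delta> w u \<le> enat R"
  then show "unique_descent G w u"
    using short_cycle_if_not_unique_descent[OF simple, of w u] by (cases "\<delta> w u") auto
qed

text \<open>An exceptional vertex lies within \<open>R\<close> of a cycle of length at most
  \<open>2 * R + 2\<close>. A union bound runs over the cycles, the at most \<open>j\<close>
  vertices of each, and the ball about each such vertex.\<close>

lemma card_not_tree_like:
  assumes "finite (verts G)"
  shows "card {v \<in> verts G. \<not> tree_like R v}
    \<le> (\<Sum>j=3..2 * R + 2. num_cycles G j * (j * (d + 1) ^ R))"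
proof -
  \<comment> \<open>Finiteness of the set of cycles must come first: \<open>num_cycles\<close> is a
    \<open>card\<close>, hence 0 on an infinite set.\<close>
  have "edges G \<subseteq> Pow (verts G)" using simple by (auto simp: simple_graph_def)
  then have "finite (edges G)" using assms finite_subset by blast
  moreover have "cycles G j \<subseteq> Pow (edges G)" for j by (auto simp: cycles_def)
  ultimately have fin_cycles: "finite (cycles G j)" for j by (meson finite_Pow_iff finite_subset)
  have cyc: "finite (\<Union>C) \<and> card (\<Union>C) \<le> j \<and> \<Union>C \<subseteq> verts G" if C: "C \<in> cycles G j" for C j
  proof -
    obtain xs where xs: "C = cycle_edges xs" "length xs = j" "set xs \<subseteq> verts G"
      using C by (auto simp: cycles_def)
    have "\<Union>C \<subseteq> set xs"
      by (auto simp: xs(1) cycle_edges_def dest: set_zip_leftD set_zip_rightD)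
    then show ?thesis
      using xs card_mono[of "set xs" "\<Union>C"] card_length[of xs] finite_subset[of "\<Union>C" "set xs"]
      by auto
  qed
  have balls: "finite (\<Union>u\<in>\<Union>C. ball_set G R u) \<and> card (\<Union>u\<in>\<Union>C. ball_set G R u) \<le> j * (d + 1) ^ R"
    if C: "C \<in> cycles G j" for C j
  proof -
    have ball: "finite (ball_set G R u)" "card (ball_set G R u) \<le> (d + 1) ^ R" if "u \<in> \<Union>C" for u
      using cyc[OF C] ball_set_bound that by blast+
    have "card (\<Union>u\<in>\<Union>C. ball_set G R u) \<le> (\<Sum>u\<in>\<Union>C. card (ball_set G R u))"
      using cyc[OF C] by (intro card_UN_le) auto
    also have "\<dots> \<le> card (\<Union>C) * (d + 1) ^ R"
      using sum_bounded_above[of "\<Union>C" "\<lambda>u. card (ball_set G R u)" "(d + 1) ^ R"] ball(2) by simp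
    also have "\<dots> \<le> j * (d + 1) ^ R" using cyc[OF C] by (intro mult_right_mono) auto
    finally show ?thesis using ball(1) cyc[OF C] by blast
  qed
  let ?B = "\<Union>j\<in>{3..2 * R + 2}. \<Union>C\<in>cycles G j. \<Union>u\<in>\<Union>C. ball_set G R u"
  have sub: "{v \<in> verts G. \<not> tree_like R v} \<subseteq> ?B"
  proof
    fix v assume "v \<in> {v \<in> verts G. \<not> tree_like R v}"
    then obtain u w where uw: "\<delta> v u \<le> enat R" "\<delta> w u \<le> enat R" "\<not> unique_descent G w u"
      by (auto simp: tree_like_def)
    obtain a where a: "\<delta> w u = enat a" "a \<le> R" using uw(2) by (cases "\<delta> w u") auto
    obtain j C where "3 \<le> j" "j \<le> 2 * a + 2" "C \<in> cycles G j" "u \<in> \<Union>C"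
      using short_cycle_if_not_unique_descent[OF simple a(1) uw(3)] by blast
    moreover have "v \<in> ball_set G R u" using uw(1) by (simp add: ball_set_def graph_dist_sym)
    moreover have "j \<in> {3..2 * R + 2}" using calculation a(2) by auto
    ultimately show "v \<in> ?B" by blast
  qed
  have "finite ?B" using fin_cycles balls by blast
  then have "card {v \<in> verts G. \<not> tree_like R v} \<le> card ?B" using sub by (rule card_mono)
  also have "\<dots> \<le> (\<Sum>j=3..2 * R + 2. card (\<Union>C\<in>cycles G j. \<Union>u\<in>\<Union>C. ball_set G R u))"
    by (intro card_UN_le) auto
  also have "\<dots> \<le> (\<Sum>j=3..2 * R + 2. num_cycles G j * (j * (d + 1) ^ R))"
  proof (rule sum_mono)
    fix j
    have "card (\<Union>C\<in>cycles G j. \<Union>u\<in>\<Union>C. ball_set G R u)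
        \<le> (\<Sum>C\<in>cycles G j. card (\<Union>u\<in>\<Union>C. ball_set G R u))"
      using fin_cycles by (intro card_UN_le) auto
    also have "\<dots> \<le> num_cycles G j * (j * (d + 1) ^ R)"
      unfolding num_cycles_def
      using sum_bounded_above[of "cycles G j" "\<lambda>C. card (\<Union>u\<in>\<Union>C. ball_set G R u)" "j * (d + 1) ^ R"]
        balls by simp
    finally show "card (\<Union>C\<in>cycles G j. \<Union>u\<in>\<Union>C. ball_set G R u) \<le> num_cycles G j * (j * (d + 1) ^ R)" .
  qed
  finally show ?thesis .
qed

text \<open>Diagonal entries at tree-like vertices equal \<open>L\<close> exactly; each of the
  others is off by at most the bound on entries plus the absolute value of \<open>L\<close>.\<close>

lemma normalized_trace_error:
  fixes k m :: nat
  defines "L \<equiv> (radial_op d k ^^ m) (\<lambda>a. if a = 0 then 1 else 0) 0"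
  assumes fin: "finite (verts G)" and ne: "verts G \<noteq> {}"
  shows "\<bar>index_mat_trace (verts G) (distance_pow k m) / real (card (verts G)) - L\<bar>
    \<le> ((real (d + 1) ^ k) ^ m + \<bar>L\<bar>) *
       (\<Sum>j=3..2 * (m * k) + 2. real (j * (d + 1) ^ (m * k)) *
          (real (num_cycles G j) / real (card (verts G))))"
proof -
  let ?n = "real (card (verts G))" and ?R = "m * k"
  let ?M = "(real (d + 1) ^ k) ^ m + \<bar>L\<bar>"
  let ?bad = "{v \<in> verts G. \<not> tree_like ?R v}"
  have n: "?n > 0" using fin ne by (simp add: card_gt_0_iff)
  have good: "distance_pow k m v v = L" if "v \<in> verts G" "tree_like ?R v" for v
    using distance_pow_radial[OF that(2), of v 0 m k] graph_dist_refl[OF that(1)]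
    by (simp add: L_def zero_enat_def)
  have term_le: "\<bar>distance_pow k m v v - L\<bar> \<le> ?M" if "v \<in> verts G" for v
    using distance_pow_bounds[OF that, of k m v] by linarith
  have "index_mat_trace (verts G) (distance_pow k m) - ?n * L
      = (\<Sum>v\<in>verts G. distance_pow k m v v - L)"
    by (simp add: index_mat_trace_def sum_subtractf)
  also have "\<dots> = (\<Sum>v\<in>?bad. distance_pow k m v v - L)"
    using fin good by (intro sum.mono_neutral_right) auto
  finally have "\<bar>index_mat_trace (verts G) (distance_pow k m) - ?n * L\<bar>
      \<le> (\<Sum>v\<in>?bad. \<bar>distance_pow k m v v - L\<bar>)" by simp
  also have "\<dots> \<le> real (card ?bad) * ?M"
    using term_le by (intro sum_bounded_above) auto
  also have "\<dots> \<le> (\<Sum>j=3..2 * ?R + 2. real (num_cycles G j) * real (j * (d + 1) ^ ?R)) * ?M"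
  proof (rule mult_right_mono)
    show "real (card ?bad) \<le> (\<Sum>j=3..2 * ?R + 2. real (num_cycles G j) * real (j * (d + 1) ^ ?R))"
      using card_not_tree_like[OF fin, of ?R] unfolding of_nat_mult[symmetric] of_nat_sum[symmetric]
      by (simp only: of_nat_le_iff)
  qed simp
  finally have le: "\<bar>index_mat_trace (verts G) (distance_pow k m) - ?n * L\<bar>
    \<le> (\<Sum>j=3..2 * ?R + 2. real (num_cycles G j) * real (j * (d + 1) ^ ?R)) * ?M" .
  have "\<bar>index_mat_trace (verts G) (distance_pow k m) / ?n - L\<bar>
      = \<bar>index_mat_trace (verts G) (distance_pow k m) - ?n * L\<bar> / ?n"
    using n by (simp add: field_simps)
  also have "\<dots> \<le> (\<Sum>j=3..2 * ?R + 2. real (num_cycles G j) * real (j * (d + 1) ^ ?R)) * ?M / ?n"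
    using le n by (intro divide_right_mono) auto
  also have "\<dots> = ?M * (\<Sum>j=3..2 * ?R + 2. real (j * (d + 1) ^ ?R) * (real (num_cycles G j) / ?n))"
    unfolding times_divide_eq_right sum_divide_distrib[symmetric] by (simp only: mult_ac)
  finally show ?thesis .
qed

end

section \<open>Passage to the limit\<close>

theorem theorem6p1:
  fixes X :: "nat \<Rightarrow> 'a sgraph" and T :: "'b sgraph" and r :: 'b and d k :: nat
  assumes "d \<ge> 2" and "k \<ge> 1"
    and "\<And>i. finite_graph (X i)" and "\<And>i. regular_graph d (X i)"
    and "filterlim (\<lambda>i. card (verts (X i))) at_top sequentially"
    and "\<And>j. j \<ge> 3 \<Longrightarrow>
           (\<lambda>i. real (num_cycles (X i) j) / real (card (verts (X i)))) \<longlonglongrightarrow> 0"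
    and "tree T" and "infinite (verts T)" and "regular_graph d T" and "r \<in> verts T"
  shows "\<forall>m\<ge>1.
           (\<lambda>i. index_mat_trace (verts (X i))
                   (index_mat_pow (verts (X i)) (adj_matrix (distance_graph k (X i))) m)
                 / real (card (verts (X i))))
           \<longlonglongrightarrow> index_mat_pow (verts T) (adj_matrix (distance_graph k T)) m r r"
proof (intro allI impI)
  fix m :: nat
  define L where "L = (radial_op d k ^^ m) (\<lambda>a. if a = 0 then 1 else 0) 0"
  interpret T: regular_sgraph T d
    using assms by unfold_locales (auto simp: tree_def)
  \<comment> \<open>The radius is written as \<open>0 + m * k\<close> to match
    \<open>a + m * k\<close> at the root, where \<open>a = 0\<close>.\<close>
  have "T.tree_like (0 + m * k) r"
    using assms(7) by (intro T.tree_like_if_no_cycles) (auto simp: tree_def)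
  then have TL: "T.distance_pow k m r r = L"
    using graph_dist_refl[OF assms(10)] unfolding L_def
    by (intro T.distance_pow_radial) (auto simp: zero_enat_def)
  let ?t = "\<lambda>i. index_mat_trace (verts (X i))
                  (index_mat_pow (verts (X i)) (adj_matrix (distance_graph k (X i))) m)
                / real (card (verts (X i)))"
  let ?e = "\<lambda>i. ((real (d + 1) ^ k) ^ m + \<bar>L\<bar>) *
       (\<Sum>j=3..2 * (m * k) + 2. real (j * (d + 1) ^ (m * k)) *
          (real (num_cycles (X i) j) / real (card (verts (X i)))))"
  \<comment> \<open>The range of \<open>j\<close> is finite and does not depend on \<open>i\<close>,
    so the limit may be taken term by term.\<close>
  have "?e \<longlonglongrightarrow> ((real (d + 1) ^ k) ^ m + \<bar>L\<bar>) *
       (\<Sum>j=3..2 * (m * k) + 2. real (j * (d + 1) ^ (m * k)) * 0)"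
    by (intro tendsto_intros assms(6)) auto
  then have e: "?e \<longlonglongrightarrow> 0" by simp
  \<comment> \<open>The error bound assumes a nonempty graph, which divergence of the vertex count
    provides only eventually.\<close>
  have "\<forall>\<^sub>F i in sequentially. 1 \<le> card (verts (X i))"
    using assms(5) by (auto simp: filterlim_at_top)
  then have "\<forall>\<^sub>F i in sequentially. norm (?t i - L) \<le> ?e i"
  proof (rule eventually_mono)
    fix i assume i: "1 \<le> card (verts (X i))"
    interpret X: regular_sgraph "X i" d
      using assms(3,4) by unfold_locales (auto simp: finite_graph_def)
    have "finite (verts (X i))" "verts (X i) \<noteq> {}"
      using assms(3)[of i] i by (auto simp: finite_graph_def)
    from X.normalized_trace_error[OF this, of k m] show "norm (?t i - L) \<le> ?e i"
      by (simp only: real_norm_def L_def)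
  qed
  then have "\<forall>\<^sub>F i in sequentially. norm (?t i - L) \<le> norm (?e i) * 1"
    by (rule eventually_mono) simp
  with e have "(\<lambda>i. ?t i - L) \<longlonglongrightarrow> 0" by (rule tendsto_0_le)
  then show "?t \<longlonglongrightarrow> T.distance_pow k m r r" unfolding TL by (simp add: LIM_zero_iff)
qed

end
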